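(* Let $B,C\in H^{\infty}$ be nonconstant functions such that $B\circ C$ is an indestructible Blaschke product. Then $B$ and $C$ are both indestructible Blaschke products.
   Context: $\mathbb{D}=\{z\in\mathbb{C}: |z|<1\}$. $H^\infty$ is the Banach space of all functions analytic and bounded in $\mathbb{D}$, equipped with the supremum norm $\|\cdot\|_\infty$. $\mathrm{Aut}(\mathbb{D})=\left\{z\mapsto \eta\,\frac{z-a}{1-\overline{a}z} : |a|<1,\ |\eta|=1\right\}$ is the group of conformal automorphisms of $\mathbb{D}$. A Blaschke product is a function on $\mathbb{D}$ of the form $$z\mapsto\eta\prod_{j}\frac{-\overline{a_j}}{|a_j|}\,\frac{z-a_j}{1-\overline{a_j}z},\qquad |\eta|=1,$$ where $(a_j)$ is a finite or infinite sequence in $\mathbb{D}$ (repetitions allowed) with $\sum_j(1-|a_j|)<\infty$, and the convention $\frac{a}{|a|}=1$ (and likewise $\frac{\overline{a}}{|a|}=1$) is used if $a=0$. A Blaschke product $F$ is called indestructible if $T\circ F$ is a Blaschke product for every $T\in\mathrm{Aut}(\mathbb{D})$.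
   Formalization: It is assumed in addition that C maps the unit disc into itself (so that B∘C is defined) and that ‖B‖_∞ ≤ 1; without the latter the claim fails, e.g. B(z)=2z, C(z)=z/2 with B∘C(z)=z. *)

theory Defs
  imports "HOL-Complex_Analysis.Complex_Analysis"
begin

text \<open>
  The open unit disc is \<^term>\<open>ball 0 1 :: complex set\<close>. Functions on the disc are total functions
  on the complex numbers; all the notions below depend only on their values on the disc.
\<close>

definition H_infty :: "(complex \<Rightarrow> complex) set" where
  "H_infty = {f. f holomorphic_on ball 0 1 \<and> bounded (f ` ball 0 1)}"

definition disc_Aut :: "(complex \<Rightarrow> complex) set" where
  "disc_Aut = {(\<lambda>z. \<eta> * ((z - a) / (1 - cnj a * z))) | \<eta> a. norm a < 1 \<and> norm \<eta> = 1}"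

text \<open>
  The conditional implements the convention that the quotient of the conjugate of \<open>a\<close> by its
  modulus is 1 for \<open>a = 0\<close>, so the factor at \<open>a = 0\<close> is \<open>-z\<close>.
\<close>

definition blaschke_factor :: "complex \<Rightarrow> complex \<Rightarrow> complex" where
  "blaschke_factor a z =
     - (if a = 0 then 1 else cnj a / of_real (norm a)) * ((z - a) / (1 - cnj a * z))"

text \<open>
  The two disjuncts are the finite (possibly empty) and the infinite products. Under the
  summability condition the infinite product converges at every point of the disc, in the sense
  of \<^const>\<open>convergent_prod\<close> (which permits finitely many zero factors).
\<close>

definition blaschke_product :: "(complex \<Rightarrow> complex) \<Rightarrow> bool" where
  "blaschke_product F \<longleftrightarrow>
     (\<exists>\<eta> a. norm \<eta> = 1 \<and>
        ((\<exists>n::nat. (\<forall>j<n. norm (a j) < 1) \<and>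
            (\<forall>z\<in>ball 0 1. F z = \<eta> * (\<Prod>j<n. blaschke_factor (a j) z)))
         \<or> ((\<forall>j. norm (a j) < 1) \<and> summable (\<lambda>j. 1 - norm (a j)) \<and>
            (\<forall>z\<in>ball 0 1. F z = \<eta> * (\<Prod>j. blaschke_factor (a j) z)))))"

definition indestructible_blaschke_product :: "(complex \<Rightarrow> complex) \<Rightarrow> bool" where
  "indestructible_blaschke_product F \<longleftrightarrow>
     blaschke_product F \<and> (\<forall>T\<in>disc_Aut. blaschke_product (T \<circ> F))"

end

theory Submission
  imports Defs
begin

text \<open>
  Write \<open>m\<^sub>b z = (z - b) / (1 - cnj b * z)\<close>. For a nonconstant holomorphic self-map \<open>F\<close> of the disc,
  Lindelof's inequality states \<open>\<bar>m\<^sub>b (F w)\<bar> \<le> \<Prod>\<^sub>a \<bar>m\<^sub>a w\<bar> ^ mult F a\<close>, the product ranging over the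
  fiber of \<open>F\<close> over \<open>b\<close>. If equality holds at a single \<open>w\<close> with \<open>F w \<noteq> b\<close>, then \<open>m\<^sub>b \<circ> F\<close> is a Blaschke
  product; conversely, for a Blaschke product equality holds everywhere. Hence \<open>F\<close> is indestructible
  iff equality holds for all \<open>b\<close>. Multiplicities multiply under composition, so applying the
  inequality to \<open>B\<close> at \<open>C w\<close> and then to \<open>C\<close> over each preimage of \<open>b\<close> under \<open>B\<close> gives a chain whose
  outer terms agree when \<open>B \<circ> C\<close> is indestructible; therefore every inequality in it is an equality.
\<close>

subsection \<open>Division by Moebius factors\<close>

abbreviation moeb :: "complex \<Rightarrow> complex \<Rightarrow> complex" where
  "moeb \<equiv> Moebius_function 0"

lemma moeb_denom_nonzero:
  assumes "norm a < 1" "norm z < 1"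
  shows "1 - cnj a * z \<noteq> 0"
proof -
  have "norm (cnj a * z) < 1"
    using assms by (metis complex_mod_cnj norm_mult_less mult_1)
  then show ?thesis
    by auto
qed

lemma moeb_eq_0_iff:
  assumes "norm a < 1" "norm z < 1"
  shows "moeb a z = 0 \<longleftrightarrow> z = a"
  using moeb_denom_nonzero[OF assms] by (simp add: Moebius_function_simple)

lemma one_minus_norm_moeb_sq:
  assumes "norm a < 1" "norm z < 1"
  shows "1 - (norm (moeb a z))\<^sup>2 = (1 - (norm a)\<^sup>2) * (1 - (norm z)\<^sup>2) / (norm (1 - cnj a * z))\<^sup>2"
proof -
  have "(norm (1 - cnj a * z))\<^sup>2 - (norm (z - a))\<^sup>2 = (1 - (norm a)\<^sup>2) * (1 - (norm z)\<^sup>2)"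
    unfolding cmod_power2 by (simp add: power2_eq_square algebra_simps)
  then show ?thesis
    using moeb_denom_nonzero[OF assms]
    by (simp add: Moebius_function_simple norm_divide power_divide field_simps)
qed

lemma norm_moeb_le_1:
  assumes "norm a < 1" "norm z < 1"
  shows "norm (moeb a z) \<le> 1"
  using Moebius_function_norm_lt_1[OF assms] by (rule less_imp_le)

lemma holomorphic_disc_isCont:
  assumes "f holomorphic_on ball 0 1" "norm z < 1"
  shows "isCont f z"
  using assms
  by (intro field_differentiable_imp_continuous_at holomorphic_on_imp_differentiable_at) auto

lemma isCont_moeb:
  assumes "norm a < 1" "norm z < 1"
  shows "isCont (moeb a) z"
  by (intro holomorphic_disc_isCont Moebius_function_holomorphic assms)

lemma Schwarz_quotient:
  assumes G: "G holomorphic_on ball 0 1" and G1: "\<And>z. norm z < 1 \<Longrightarrow> norm (G z) \<le> 1"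
    and a: "norm a < 1" and Ga: "G a = 0"
  obtains K where "K holomorphic_on ball 0 1" "\<And>z. norm z < 1 \<Longrightarrow> norm (K z) \<le> 1"
    "\<And>z. norm z < 1 \<Longrightarrow> G z = moeb a z * K z"
proof -
  have ma: "norm (-a) < 1"
    using a by simp
  have le: "norm (G z) \<le> norm (moeb a z)" if z: "norm z < 1" for z
  proof (rule field_le_mult_one_interval)
    fix t :: real
    assume t: "0 < t" "t < 1"
    define f where "f = (\<lambda>u. of_real t * G (moeb (-a) u))"
    have "norm (f (moeb a z)) \<le> norm (moeb a z)"
    proof (rule Schwarz_Lemma)
      have "G \<circ> moeb (-a) holomorphic_on ball 0 1"
        using Moebius_function_norm_lt_1[OF ma]
        by (intro holomorphic_on_compose_gen[OF Moebius_function_holomorphic[OF ma] G]) auto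
      then show "f holomorphic_on ball 0 1"
        unfolding f_def by (intro holomorphic_intros) (simp_all add: o_def)
      show "f 0 = 0"
        by (simp add: f_def Moebius_function_of_zero Ga)
      show "norm (f u) < 1" if "norm u < 1" for u
      proof -
        have "norm (f u) \<le> t"
          using t G1[OF Moebius_function_norm_lt_1[OF ma that], of 0]
          by (simp add: f_def norm_mult mult_left_le)
        then show ?thesis
          using t by simp
      qed
      show "norm (moeb a z) < 1"
        by (rule Moebius_function_norm_lt_1[OF a z])
    qed
    then show "t * norm (G z) \<le> norm (moeb a z)"
      using t Moebius_function_compose[of "-a" a z] a z by (simp add: f_def norm_mult)
  qed
  define H where "H = (\<lambda>z. if z = a then deriv G a else (G z - G a) / (z - a))"
  define K where "K = (\<lambda>z. (1 - cnj a * z) * H z)"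
  have K: "K holomorphic_on ball 0 1"
    unfolding K_def H_def by (intro holomorphic_intros pole_lemma_open G) auto
  have eq: "G z = moeb a z * K z" if "norm z < 1" for z
    using moeb_denom_nonzero[OF a that]
    by (simp add: Moebius_function_simple K_def H_def Ga)
  have K1: "norm (K z) \<le> 1" if z: "norm z < 1" "z \<noteq> a" for z
    using le[OF z(1)] z moeb_eq_0_iff[OF a z(1)] by (simp add: eq norm_mult)
  have "norm (K a) \<le> 1"
  proof (rule tendsto_upperbound)
    have "isCont K a"
      by (intro holomorphic_disc_isCont K a)
    then show "((\<lambda>z. norm (K z)) \<longlongrightarrow> norm (K a)) (at a)"
      by (intro tendsto_norm) (simp add: isCont_def)
    have "\<forall>\<^sub>F z in at a. z \<in> ball 0 1 \<and> z \<noteq> a"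
      using a by (intro eventually_conj eventually_at_in_open' eventually_neq_at_within) auto
    then show "\<forall>\<^sub>F z in at a. norm (K z) \<le> 1"
      by eventually_elim (use K1 in auto)
  qed simp
  with K1 have "norm (K z) \<le> 1" if "norm z < 1" for z
    using that by (cases "z = a") auto
  with K eq show ?thesis
    using that by blast
qed

lemma isCont_imp_bigo_1:
  fixes f :: "complex \<Rightarrow> complex"
  assumes "isCont f a"
  shows "f \<in> O[at a](\<lambda>_. 1)"
  using assms by (intro bigoI_tendsto[where c = "f a"]) (auto simp: isCont_def)

lemma Schwarz_quotient_prod:
  assumes "finite Q" and "G holomorphic_on ball 0 1" and "\<And>z. norm z < 1 \<Longrightarrow> norm (G z) \<le> 1"
    and "\<And>i. i \<in> Q \<Longrightarrow> norm (p i) < 1"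
    and "\<And>a. a \<in> p ` Q \<Longrightarrow> G \<in> O[at a](\<lambda>z. (z - a) ^ card {i\<in>Q. p i = a})"
  shows "\<exists>K. K holomorphic_on ball 0 1 \<and> (\<forall>z. norm z < 1 \<longrightarrow> norm (K z) \<le> 1) \<and>
           (\<forall>z. norm z < 1 \<longrightarrow> G z = (\<Prod>i\<in>Q. moeb (p i) z) * K z)"
  using assms
proof (induction Q arbitrary: G rule: finite_induct)
  case empty
  then show ?case
    by (intro exI[of _ G]) auto
next
  case (insert q Q)
  define a where "a = p q"
  have a: "norm a < 1"
    using insert.prems by (simp add: a_def)
  have card_a: "card {i \<in> insert q Q. p i = a} = Suc (card {i\<in>Q. p i = a})"
  proof -
    have "{i \<in> insert q Q. p i = a} = insert q {i\<in>Q. p i = a}"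
      by (auto simp: a_def)
    then show ?thesis
      using insert.hyps by simp
  qed
  have Ga_bigo: "G \<in> O[at a](\<lambda>z. (z - a) ^ Suc (card {i\<in>Q. p i = a}))"
    using insert.prems(4)[of a] card_a by (simp add: a_def)
  have contG: "isCont G a"
    by (intro holomorphic_disc_isCont insert.prems a)
  have "G a = 0"
  proof -
    have "((\<lambda>z. (z - a) ^ Suc (card {i\<in>Q. p i = a})) \<longlongrightarrow> 0) (at a)"
      by (rule tendsto_eq_intros refl | simp)+
    then have "(\<lambda>z. (z - a) ^ Suc (card {i\<in>Q. p i = a})) \<in> o[at a](\<lambda>_. 1)"
      by (intro smalloI_tendsto) auto
    with Ga_bigo have "G \<in> o[at a](\<lambda>_. 1)"
      by (rule landau_o.big_small_trans)
    then have "(G \<longlongrightarrow> 0) (at a)"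
      using smalloD_tendsto by fastforce
    then show ?thesis
      using contG by (simp add: isCont_def LIM_unique)
  qed
  then obtain K where K: "K holomorphic_on ball 0 1" "\<And>z. norm z < 1 \<Longrightarrow> norm (K z) \<le> 1"
      and GK: "\<And>z. norm z < 1 \<Longrightarrow> G z = moeb a z * K z"
    using Schwarz_quotient insert.prems(1,2) a by metis
  have "K \<in> O[at c](\<lambda>z. (z - c) ^ card {i\<in>Q. p i = c})" if c: "c \<in> p ` Q" for c
  proof -
    have c1: "norm c < 1"
      using c insert.prems(3) by auto
    have in_disc: "\<forall>\<^sub>F z in at c. z \<in> ball 0 1"
      using c1 by (intro eventually_at_in_open') auto
    show ?thesis
    proof (cases "c = a")
      case True
      have "(\<lambda>z. G z * (1 - cnj a * z)) \<in> O[at a](\<lambda>z. (z - a) ^ Suc (card {i\<in>Q. p i = a}) * 1)"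
        by (intro landau_o.big.mult Ga_bigo isCont_imp_bigo_1) (intro continuous_intros)
      moreover have "\<forall>\<^sub>F z in at a. G z * (1 - cnj a * z) = (z - a) * K z"
        using in_disc unfolding True
        by eventually_elim
          (use moeb_denom_nonzero[OF a] in \<open>simp add: GK Moebius_function_simple\<close>)
      ultimately have "(\<lambda>z. (z - a) * K z) \<in> O[at a](\<lambda>z. (z - a) * (z - a) ^ card {i\<in>Q. p i = a})"
        by (simp add: landau_o.big.in_cong)
      moreover have "\<forall>\<^sub>F z in at a. z - a \<noteq> 0"
        using eventually_neq_at_within[of a a UNIV] by eventually_elim auto
      ultimately show ?thesis
        unfolding True by (subst (asm) landau_o.big.mult_cancel_left) auto
    next
      case False
      have "G \<in> O[at c](\<lambda>z. (z - c) ^ card {i\<in>Q. p i = c})"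
      proof -
        have "{i \<in> insert q Q. p i = c} = {i\<in>Q. p i = c}"
          using False by (auto simp: a_def)
        then show ?thesis
          using insert.prems(4)[of c] c by auto
      qed
      moreover have "(\<lambda>z. inverse (moeb a z)) \<in> O[at c](\<lambda>_. 1)"
        using moeb_eq_0_iff[OF a c1] False isCont_moeb[OF a c1]
        by (intro isCont_imp_bigo_1 continuous_at_within_inverse) auto
      ultimately have "(\<lambda>z. G z * inverse (moeb a z)) \<in> O[at c](\<lambda>z. (z - c) ^ card {i\<in>Q. p i = c} * 1)"
        by (rule landau_o.big.mult)
      moreover have "\<forall>\<^sub>F z in at c. G z * inverse (moeb a z) = K z"
      proof -
        have "\<forall>\<^sub>F z in at c. z \<noteq> a"
          by (simp add: False eventually_neq_at_within)
        with in_disc show ?thesis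
          by eventually_elim (use moeb_eq_0_iff[OF a] in \<open>simp add: GK\<close>)
      qed
      ultimately show ?thesis
        by (simp add: landau_o.big.in_cong)
    qed
  qed
  then obtain L where L: "L holomorphic_on ball 0 1" "\<And>z. norm z < 1 \<Longrightarrow> norm (L z) \<le> 1"
      "\<And>z. norm z < 1 \<Longrightarrow> K z = (\<Prod>i\<in>Q. moeb (p i) z) * L z"
    using insert.IH[OF K] insert.prems(3) by auto
  then show ?case
    using insert.hyps GK by (intro exI[of _ L]) (auto simp: a_def mult.assoc)
qed

subsection \<open>Multiplicities\<close>

text \<open>Junk value if \<open>F - F a\<close> has no exact order at \<open>a\<close>, in particular if \<open>F\<close> is constant.\<close>

definition mult_at :: "(complex \<Rightarrow> complex) \<Rightarrow> complex \<Rightarrow> nat" where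
  "mult_at F a = (SOME m. (\<lambda>z. F z - F a) \<in> \<Theta>[at a](\<lambda>z. (z - a) ^ m))"

lemma eventually_at_diff_nonzero: "\<forall>\<^sub>F z in at a. z - a \<noteq> (0::complex)"
  by (simp add: eventually_neq_at_within)

lemma power_bigo_power_at:
  assumes "(\<lambda>z. (z - a) ^ m) \<in> O[at a](\<lambda>z. (z - a :: complex) ^ n)"
  shows "n \<le> m"
proof (rule ccontr)
  assume "\<not> n \<le> m"
  have "((\<lambda>z. (z - a) ^ (n - m)) \<longlongrightarrow> 0) (at a)"
    using \<open>\<not> n \<le> m\<close> by (auto intro!: tendsto_eq_intros)
  moreover have "\<forall>\<^sub>F z in at a. (z - a) ^ (n - m) = (z - a) ^ n / (z - a) ^ m"
    using eventually_at_diff_nonzero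
    by eventually_elim (use \<open>\<not> n \<le> m\<close> in \<open>simp add: power_diff\<close>)
  ultimately have "((\<lambda>z. (z - a) ^ n / (z - a) ^ m) \<longlongrightarrow> 0) (at a)"
    by (rule Lim_transform_eventually)
  then have "(\<lambda>z. (z - a) ^ n) \<in> o[at a](\<lambda>z. (z - a) ^ m)"
    by (rule smalloI_tendsto) (use eventually_at_diff_nonzero in eventually_elim, simp)
  then have "\<forall>\<^sub>F z in at a. (z - a) ^ n = 0"
    using assms by (rule landau_o.small_big_asymmetric)
  with eventually_at_diff_nonzero have "\<forall>\<^sub>F z in at a. False"
    by eventually_elim simp
  then show False
    by simp
qed

lemma mult_at_eqI:
  assumes "(\<lambda>z. F z - F a) \<in> \<Theta>[at a](\<lambda>z. (z - a) ^ n)"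
  shows "mult_at F a = n"
  unfolding mult_at_def
proof (rule some_equality)
  fix m assume m: "(\<lambda>z. F z - F a) \<in> \<Theta>[at a](\<lambda>z. (z - a) ^ m)"
  then have "(\<lambda>z. (z - a) ^ m) \<in> \<Theta>[at a](\<lambda>z. (z - a) ^ n)"
    using assms landau_theta.trans bigtheta_sym by blast
  then show "m = n"
    using power_bigo_power_at bigtheta_sym bigthetaD1 by (metis order_antisym)
qed (rule assms)

lemma mult_at:
  assumes F: "F holomorphic_on ball 0 1" "\<not> F constant_on ball 0 1" and a: "norm a < 1"
  shows mult_at_bigtheta: "(\<lambda>z. F z - F a) \<in> \<Theta>[at a](\<lambda>z. (z - a) ^ mult_at F a)"
    and mult_at_pos: "0 < mult_at F a"
proof -
  obtain g r n where n: "0 < n" and r: "0 < r" and g: "g holomorphic_on ball a r"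
    and eq: "\<And>w. w \<in> ball a r \<Longrightarrow> F w - F a = (w - a) ^ n * g w"
    and nz: "\<And>w. w \<in> ball a r \<Longrightarrow> g w \<noteq> 0"
  proof (rule holomorphic_factor_zero_nonconstant[of "\<lambda>z. F z - F a" "ball 0 1" a])
    show "(\<lambda>z. F z - F a) holomorphic_on ball 0 1"
      by (intro holomorphic_intros F)
    show "\<not> (\<lambda>z. F z - F a) constant_on ball 0 1"
      using F(2) unfolding constant_on_def by (metis diff_add_cancel)
  qed (use a in auto)
  have "\<forall>\<^sub>F z in at a. z \<in> ball a r"
    using r by (intro eventually_at_in_open') auto
  then have "\<forall>\<^sub>F z in at a. g z = (F z - F a) / (z - a) ^ n"
    using eventually_at_diff_nonzero by eventually_elim (simp add: eq)
  moreover have "(g \<longlongrightarrow> g a) (at a)"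
    using holomorphic_on_imp_continuous_on[OF g] r
    by (simp add: continuous_on_eq_continuous_at isCont_def)
  ultimately have "((\<lambda>z. (F z - F a) / (z - a) ^ n) \<longlongrightarrow> g a) (at a)"
    by (rule Lim_transform_eventually[rotated])
  moreover have "\<forall>\<^sub>F z in at a. (z - a) ^ n \<noteq> 0"
    using eventually_at_diff_nonzero by eventually_elim simp
  ultimately have "(\<lambda>z. F z - F a) \<in> \<Theta>[at a](\<lambda>z. (z - a) ^ n)"
    using nz[of a] r by (intro bigthetaI_tendsto_norm[OF _ tendsto_norm]) auto
  with mult_at_eqI[OF this] n show "(\<lambda>z. F z - F a) \<in> \<Theta>[at a](\<lambda>z. (z - a) ^ mult_at F a)"
    "0 < mult_at F a"
    by auto
qed

lemma mult_at_compose: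
  assumes C: "C holomorphic_on ball 0 1" "\<not> C constant_on ball 0 1" and a: "norm a < 1"
    and B: "B holomorphic_on ball 0 1" "\<not> B constant_on ball 0 1" and Ca: "norm (C a) < 1"
  shows "mult_at (B \<circ> C) a = mult_at B (C a) * mult_at C a"
proof (rule mult_at_eqI)
  note thC = mult_at_bigtheta[OF C a]
  have "\<forall>\<^sub>F z in at a. (z - a) ^ mult_at C a \<noteq> 0"
    using eventually_at_diff_nonzero by eventually_elim simp
  then have "\<forall>\<^sub>F z in at a. C z - C a \<noteq> 0"
    using eventually_nonzero_bigtheta[OF thC] by simp
  moreover have "(C \<longlongrightarrow> C a) (at a)"
    using holomorphic_disc_isCont[OF C(1) a] by (simp add: isCont_def)
  ultimately have "filterlim C (at (C a)) (at a)"
    by (simp add: filterlim_at)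
  then have "(\<lambda>z. B (C z) - B (C a)) \<in> \<Theta>[at a](\<lambda>z. (C z - C a) ^ mult_at B (C a))"
    by (rule landau_theta.compose[OF mult_at_bigtheta[OF B Ca]])
  also have "(\<lambda>z. (C z - C a) ^ mult_at B (C a)) \<in> \<Theta>[at a](\<lambda>z. ((z - a) ^ mult_at C a) ^ mult_at B (C a))"
    using thC by (intro bigthetaI landau_o.big_power landau_omega.big_power) auto
  finally show "(\<lambda>z. (B \<circ> C) z - (B \<circ> C) a) \<in> \<Theta>[at a](\<lambda>z. (z - a) ^ (mult_at B (C a) * mult_at C a))"
    by (simp add: power_mult mult.commute)
qed

lemma moeb_compose_bigtheta:
  assumes F: "F holomorphic_on ball 0 1" "\<not> F constant_on ball 0 1" and a: "norm a < 1"
    and Fa: "norm (F a) < 1"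
  shows "(\<lambda>z. moeb (F a) (F z)) \<in> \<Theta>[at a](\<lambda>z. (z - a) ^ mult_at F a)"
proof -
  have "(F \<longlongrightarrow> F a) (at a)"
    using holomorphic_disc_isCont[OF F(1) a] by (simp add: isCont_def)
  then have "((\<lambda>z. 1 - cnj (F a) * F z) \<longlongrightarrow> 1 - cnj (F a) * F a) (at a)"
    by (intro tendsto_intros)
  then have "(\<lambda>z. 1 - cnj (F a) * F z) \<in> \<Theta>[at a](\<lambda>_. 1)"
    using moeb_denom_nonzero[OF Fa Fa]
    by (intro bigthetaI_tendsto_norm[where c = "norm (1 - cnj (F a) * F a)"]) (auto intro!: tendsto_norm)
  with mult_at_bigtheta[OF F a]
  have "(\<lambda>z. (F z - F a) * inverse (1 - cnj (F a) * F z))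
          \<in> \<Theta>[at a](\<lambda>z. (z - a) ^ mult_at F a * inverse 1)"
    by (intro landau_theta.mult) (simp_all only: bigtheta_inverse)
  then show ?thesis
    by (simp add: Moebius_function_simple field_simps)
qed

subsection \<open>Lindelof's inequality\<close>

definition fiber :: "(complex \<Rightarrow> complex) \<Rightarrow> complex \<Rightarrow> complex set" where
  "fiber F b = {a. norm a < 1 \<and> F a = b}"

lemma Lindelof_quotient:
  assumes F: "F holomorphic_on ball 0 1" "\<not> F constant_on ball 0 1"
    and F1: "\<And>z. norm z < 1 \<Longrightarrow> norm (F z) < 1" and b: "norm b < 1"
    and Q: "finite Q" "Q \<subseteq> (SIGMA a:fiber F b. {..<mult_at F a})"
  shows "\<exists>K. K holomorphic_on ball 0 1 \<and> (\<forall>z. norm z < 1 \<longrightarrow> norm (K z) \<le> 1) \<and>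
           (\<forall>z. norm z < 1 \<longrightarrow> moeb b (F z) = (\<Prod>q\<in>Q. moeb (fst q) z) * K z)"
proof (rule Schwarz_quotient_prod[OF Q(1)])
  have "moeb b \<circ> F holomorphic_on ball 0 1"
    using F1 by (intro holomorphic_on_compose_gen[OF F(1) Moebius_function_holomorphic[OF b]]) auto
  then show "(\<lambda>z. moeb b (F z)) holomorphic_on ball 0 1"
    by (simp add: o_def)
  show "norm (moeb b (F z)) \<le> 1" if "norm z < 1" for z
    using norm_moeb_le_1[OF b F1[OF that]] .
  show "norm (fst q) < 1" if "q \<in> Q" for q
    using that Q(2) by (auto simp: fiber_def)
  show "(\<lambda>z. moeb b (F z)) \<in> O[at a](\<lambda>z. (z - a) ^ card {q \<in> Q. fst q = a})" if "a \<in> fst ` Q" for a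
  proof -
    have a: "norm a < 1" "F a = b"
      using that Q(2) by (auto simp: fiber_def)
    have "{q \<in> Q. fst q = a} \<subseteq> {a} \<times> {..<mult_at F a}"
      using Q(2) by auto
    then have "card {q \<in> Q. fst q = a} \<le> card ({a} \<times> {..<mult_at F a})"
      by (intro card_mono) auto
    then have le: "card {q \<in> Q. fst q = a} \<le> mult_at F a"
      by simp
    have "(\<lambda>z. (z - a) ^ card {q \<in> Q. fst q = a} * (z - a) ^ (mult_at F a - card {q \<in> Q. fst q = a}))
        \<in> O[at a](\<lambda>z. (z - a) ^ card {q \<in> Q. fst q = a} * 1)"
      by (intro landau_o.big.mult isCont_imp_bigo_1) (auto intro!: continuous_intros)
    then have "(\<lambda>z. (z - a) ^ mult_at F a) \<in> O[at a](\<lambda>z. (z - a) ^ card {q \<in> Q. fst q = a})"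
      using le by (simp flip: power_add)
    then show ?thesis
      using moeb_compose_bigtheta[OF F a(1)] a F1 landau_o.big_trans by blast
  qed
qed

lemma Lindelof_inequality:
  assumes F: "F holomorphic_on ball 0 1" "\<not> F constant_on ball 0 1"
    and F1: "\<And>z. norm z < 1 \<Longrightarrow> norm (F z) < 1" and b: "norm b < 1"
    and S: "finite S" "S \<subseteq> fiber F b" and w: "norm w < 1"
  shows "norm (moeb b (F w)) \<le> (\<Prod>a\<in>S. norm (moeb a w) ^ mult_at F a)"
proof -
  define Q where "Q = (SIGMA a:S. {..<mult_at F a})"
  obtain K where K: "norm (K w) \<le> 1" "moeb b (F w) = (\<Prod>q\<in>Q. moeb (fst q) w) * K w"
    using Lindelof_quotient[OF F F1 b, of Q] S w by (auto simp: Q_def)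
  have "norm (moeb b (F w)) \<le> (\<Prod>q\<in>Q. norm (moeb (fst q) w))"
    using K by (simp add: norm_mult prod_norm mult_left_le)
  also have "\<dots> = (\<Prod>a\<in>S. \<Prod>i<mult_at F a. norm (moeb a w))"
    using S by (subst prod.Sigma) (simp_all add: Q_def split_def)
  finally show ?thesis
    by simp
qed

text \<open>
  By \<open>Lindelof_inequality\<close>, this says that \<open>norm (moeb b (F w))\<close> is the product over the whole
  fiber, that is, the infimum of the finite subproducts.
\<close>

definition Lindelof_equality :: "(complex \<Rightarrow> complex) \<Rightarrow> complex \<Rightarrow> complex \<Rightarrow> bool" where
  "Lindelof_equality F b w \<longleftrightarrow>
     (\<forall>e>0. \<exists>S. finite S \<and> S \<subseteq> fiber F b \<and>
        (\<Prod>a\<in>S. norm (moeb a w) ^ mult_at F a) \<le> norm (moeb b (F w)) + e)"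

subsection \<open>Blaschke products and equality in Lindelof's inequality\<close>

definition unit_factor :: "complex \<Rightarrow> complex" where
  "unit_factor a = - (if a = 0 then 1 else cnj a / of_real (norm a))"

lemma norm_unit_factor: "norm (unit_factor a) = 1"
  by (simp add: unit_factor_def norm_divide)

lemma blaschke_factor_moeb: "blaschke_factor a z = unit_factor a * moeb a z"
  by (simp add: blaschke_factor_def unit_factor_def Moebius_function_simple)

lemma norm_blaschke_factor: "norm (blaschke_factor a z) = norm (moeb a z)"
  by (simp add: blaschke_factor_moeb norm_mult norm_unit_factor)

lemma norm_one_minus_blaschke_factor:
  assumes "norm a < 1" "norm z < 1"
  shows "norm (blaschke_factor a z - 1) \<le> 2 / (1 - norm z) * (1 - norm a)"
proof -
  define u where "u = (if a = 0 then 1 else cnj a / of_real (norm a))"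
  have u: "norm u = 1" "u * a = of_real (norm a)" "cnj a = u * of_real (norm a)"
    using complex_norm_square[of a]
    by (auto simp: u_def norm_divide power2_eq_square field_simps)
  have nz: "1 - cnj a * z \<noteq> 0"
    using moeb_denom_nonzero[OF assms] .
  have "blaschke_factor a z - 1 = - u * (z - a) / (1 - cnj a * z) - (1 - cnj a * z) / (1 - cnj a * z)"
    using nz by (simp add: blaschke_factor_def u_def)
  also have "\<dots> = (- u * (z - a) - (1 - cnj a * z)) / (1 - cnj a * z)"
    by (rule diff_divide_distrib [symmetric])
  also have "- u * (z - a) - (1 - cnj a * z) = - ((1 - u * a) * (1 + u * z)) + (cnj a - u * (u * a)) * z"
    by (simp add: algebra_simps)
  also have "\<dots> = - ((1 - of_real (norm a)) * (1 + u * z))"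
    by (simp only: u(2) flip: u(3)) simp
  finally have "blaschke_factor a z - 1 = - ((1 - of_real (norm a)) * (1 + u * z)) / (1 - cnj a * z)" .
  moreover have "norm (1 - complex_of_real (norm a)) = 1 - norm a"
    using assms norm_of_real[of "1 - norm a", where 'a = complex] by simp
  ultimately have "norm (blaschke_factor a z - 1) = (1 - norm a) * norm (1 + u * z) / norm (1 - cnj a * z)"
    by (simp only: norm_mult norm_divide norm_minus_cancel)
  also have "\<dots> \<le> (1 - norm a) * 2 / (1 - norm z)"
  proof (rule frac_le)
    have "norm (1 + u * z) \<le> 2"
      using norm_triangle_ineq[of 1 "u * z"] assms u(1) by (simp add: norm_mult)
    then show "(1 - norm a) * norm (1 + u * z) \<le> (1 - norm a) * 2"
      using assms by (intro mult_left_mono) auto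
    have "norm (cnj a * z) \<le> norm z"
      using assms by (simp add: norm_mult mult_left_le_one_le)
    then show "1 - norm z \<le> norm (1 - cnj a * z)"
      using norm_triangle_ineq2[of 1 "cnj a * z"] by simp
  qed (use assms in auto)
  finally show ?thesis
    by (simp add: mult.commute)
qed

lemma blaschke_product_LIMSEQ:
  assumes a: "\<And>j. norm (a j) < 1" "summable (\<lambda>j. 1 - norm (a j))" and z: "norm z < 1"
  shows "(\<lambda>n. \<Prod>j\<le>n. blaschke_factor (a j) z) \<longlonglongrightarrow> (\<Prod>j. blaschke_factor (a j) z)"
proof -
  have "summable (\<lambda>j. norm (blaschke_factor (a j) z - 1))"
  proof (rule summable_comparison_test')
    show "summable (\<lambda>j. 2 / (1 - norm z) * (1 - norm (a j)))"
      by (intro summable_mult a)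
    show "norm (norm (blaschke_factor (a j) z - 1)) \<le> 2 / (1 - norm z) * (1 - norm (a j))" for j
      using norm_one_minus_blaschke_factor[OF a(1) z] by simp
  qed
  then have "convergent_prod (\<lambda>j. blaschke_factor (a j) z)"
    by (intro abs_convergent_prod_imp_convergent_prod) (simp add: abs_convergent_prod_conv_summable)
  then show ?thesis
    by (rule convergent_prod_LIMSEQ)
qed

lemma prod_fiber_le:
  assumes F: "F holomorphic_on ball 0 1" "\<not> F constant_on ball 0 1"
    and F1: "\<And>z. norm z < 1 \<Longrightarrow> norm (F z) < 1" and b: "norm b < 1"
    and J: "finite J" "\<And>j. j \<in> J \<Longrightarrow> norm (a j) < 1"
    and le: "\<And>z. norm z < 1 \<Longrightarrow> norm (moeb b (F z)) \<le> (\<Prod>j\<in>J. norm (moeb (a j) z))"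
    and w: "norm w < 1"
  shows "\<exists>S. finite S \<and> S \<subseteq> fiber F b \<and>
           (\<Prod>a\<in>S. norm (moeb a w) ^ mult_at F a) \<le> (\<Prod>j\<in>J. norm (moeb (a j) w))"
proof (intro exI conjI)
  have prod_eq: "(\<Prod>j\<in>J. norm (moeb (a j) z)) = (\<Prod>x\<in>a ` J. norm (moeb x z) ^ card {j\<in>J. a j = x})" for z
  proof -
    have "(\<Prod>j\<in>J. norm (moeb (a j) z)) = (\<Prod>x\<in>a ` J. \<Prod>j\<in>{j\<in>J. a j = x}. norm (moeb (a j) z))"
      by (rule prod.image_gen[OF J(1)])
    also have "\<dots> = (\<Prod>x\<in>a ` J. norm (moeb x z) ^ card {j\<in>J. a j = x})"
      by (intro prod.cong refl) (simp flip: prod_constant)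
    finally show ?thesis .
  qed
  show "finite (a ` J)"
    using J by simp
  have Fx: "F x = b" "norm x < 1" if x: "x \<in> a ` J" for x
  proof -
    show x1: "norm x < 1"
      using x J by auto
    have "(\<Prod>j\<in>J. norm (moeb (a j) x)) = 0"
      using x by (intro prod_zero J) (auto intro: Moebius_function_eq_zero)
    then have "moeb b (F x) = 0"
      using le[OF x1] by simp
    then show "F x = b"
      using moeb_eq_0_iff[OF b F1[OF x1]] by simp
  qed
  then show "a ` J \<subseteq> fiber F b"
    by (auto simp: fiber_def)
  have "card {j\<in>J. a j = x} \<le> mult_at F x" if x: "x \<in> a ` J" for x
  proof (rule power_bigo_power_at)
    note x1 = Fx(2)[OF x]
    have "(\<lambda>z. moeb b (F z)) \<in> O[at x](\<lambda>z. moeb x z ^ card {j\<in>J. a j = x})"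
    proof (rule landau_o.bigI[of 1])
      have "\<forall>\<^sub>F z in at x. z \<in> ball 0 1"
        using x1 by (intro eventually_at_in_open') auto
      then show "\<forall>\<^sub>F z in at x. norm (moeb b (F z)) \<le> 1 * norm (moeb x z ^ card {j\<in>J. a j = x})"
      proof eventually_elim
        case (elim z)
        then have z: "norm z < 1"
          by simp
        have "norm (moeb b (F z)) \<le> (\<Prod>y\<in>a ` J. norm (moeb y z) ^ card {j\<in>J. a j = y})"
          using le[OF z] by (simp only: prod_eq)
        also have "\<dots> = norm (moeb x z) ^ card {j\<in>J. a j = x} *
            (\<Prod>y\<in>a ` J - {x}. norm (moeb y z) ^ card {j\<in>J. a j = y})"
          using J(1) x by (intro prod.remove) auto
        also have "\<dots> \<le> norm (moeb x z) ^ card {j\<in>J. a j = x} * 1"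
          using norm_moeb_le_1[OF J(2) z]
          by (intro mult_left_mono prod_le_1) (auto intro!: power_le_one)
        finally show ?case
          by (simp add: norm_power)
      qed
    qed simp
    also have "(\<lambda>z. moeb x z ^ card {j\<in>J. a j = x}) \<in> O[at x](\<lambda>z. (z - x) ^ card {j\<in>J. a j = x})"
    proof (rule landau_o.big_power)
      have "(\<lambda>z. (z - x) * inverse (1 - cnj x * z)) \<in> O[at x](\<lambda>z. (z - x) * 1)"
        using moeb_denom_nonzero[OF x1 x1]
        by (intro landau_o.big.mult isCont_imp_bigo_1) (auto intro!: continuous_intros)
      then show "moeb x \<in> O[at x](\<lambda>z. z - x)"
        by (simp add: Moebius_function_simple[abs_def] field_simps)
    qed
    finally have "(\<lambda>z. moeb (F x) (F z)) \<in> O[at x](\<lambda>z. (z - x) ^ card {j\<in>J. a j = x})"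
      using Fx(1)[OF x] by simp
    then show "(\<lambda>z. (z - x) ^ mult_at F x) \<in> O[at x](\<lambda>z. (z - x) ^ card {j\<in>J. a j = x})"
      using landau_o.big.in_cong_bigtheta[OF moeb_compose_bigtheta[OF F x1 F1[OF x1]]] by simp
  qed
  then show "(\<Prod>x\<in>a ` J. norm (moeb x w) ^ mult_at F x) \<le> (\<Prod>j\<in>J. norm (moeb (a j) w))"
    unfolding prod_eq using Fx(2) norm_moeb_le_1[OF _ w]
    by (intro prod_mono conjI power_decreasing) auto
qed

lemma blaschke_product_imp_Lindelof_equality:
  assumes F: "F holomorphic_on ball 0 1" "\<not> F constant_on ball 0 1"
    and F1: "\<And>z. norm z < 1 \<Longrightarrow> norm (F z) < 1" and b: "norm b < 1" and w: "norm w < 1"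
    and bp: "blaschke_product (\<lambda>z. moeb b (F z))"
  shows "Lindelof_equality F b w"
  unfolding Lindelof_equality_def
proof (intro allI impI)
  fix e :: real assume e: "e > 0"
  have "\<exists>J (a :: nat \<Rightarrow> complex). finite J \<and> (\<forall>j\<in>J. norm (a j) < 1) \<and>
      (\<forall>z. norm z < 1 \<longrightarrow> norm (moeb b (F z)) \<le> (\<Prod>j\<in>J. norm (moeb (a j) z))) \<and>
      (\<Prod>j\<in>J. norm (moeb (a j) w)) \<le> norm (moeb b (F w)) + e"
  proof -
    obtain \<eta> a where \<eta>: "norm \<eta> = 1" and
      "(\<exists>n::nat. (\<forall>j<n. norm (a j) < 1) \<and>
          (\<forall>z\<in>ball 0 1. moeb b (F z) = \<eta> * (\<Prod>j<n. blaschke_factor (a j) z)))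
       \<or> ((\<forall>j. norm (a j) < 1) \<and> summable (\<lambda>j. 1 - norm (a j)) \<and>
          (\<forall>z\<in>ball 0 1. moeb b (F z) = \<eta> * (\<Prod>j. blaschke_factor (a j) z)))"
      using bp unfolding blaschke_product_def by (elim exE conjE) (rule that)
    then consider (fin) n :: nat where "\<forall>j<n. norm (a j) < 1"
        "\<forall>z\<in>ball 0 1. moeb b (F z) = \<eta> * (\<Prod>j<n. blaschke_factor (a j) z)"
      | (inf) "\<forall>j. norm (a j) < 1" "summable (\<lambda>j. 1 - norm (a j))"
        "\<forall>z\<in>ball 0 1. moeb b (F z) = \<eta> * (\<Prod>j. blaschke_factor (a j) z)"
      by (elim disjE exE conjE) (rule that; assumption)+
    then show ?thesis
    proof cases
      case fin
      have "norm (moeb b (F z)) = (\<Prod>j<n. norm (moeb (a j) z))" if "norm z < 1" for z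
        using that by (simp add: fin(2)[rule_format] norm_mult \<eta> norm_blaschke_factor flip: prod_norm)
      with fin(1) w e show ?thesis
        by (intro exI[of _ "{..<n}"] exI[of _ a]) auto
    next
      case inf
      define P where "P = (\<lambda>n z. \<Prod>j\<le>n. norm (moeb (a j) z))"
      have lim: "(\<lambda>n. P n z) \<longlonglongrightarrow> norm (moeb b (F z))" if z: "norm z < 1" for z
      proof -
        have "norm (moeb b (F z)) = norm (\<Prod>j. blaschke_factor (a j) z)"
          using inf(3)[rule_format, of z] z \<eta> by (simp add: norm_mult)
        moreover have "P n z = norm (\<Prod>j\<le>n. blaschke_factor (a j) z)" for n
          by (simp only: P_def norm_blaschke_factor flip: prod_norm)
        ultimately show ?thesis
          using tendsto_norm[OF blaschke_product_LIMSEQ[OF inf(1)[rule_format] inf(2) z]] by simp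
      qed
      have "decseq (\<lambda>n. P n z)" if z: "norm z < 1" for z
        unfolding P_def using norm_moeb_le_1[OF inf(1)[rule_format] z]
        by (intro decseq_SucI) (simp add: mult_left_le prod_nonneg)
      then have "norm (moeb b (F z)) \<le> P n z" if "norm z < 1" for z n
        using decseq_ge lim that by blast
      moreover have "\<forall>\<^sub>F n in sequentially. P n w < norm (moeb b (F w)) + e"
        using lim[OF w] e by (intro order_tendstoD) auto
      then obtain n where "P n w < norm (moeb b (F w)) + e"
        by (auto simp: eventually_sequentially)
      ultimately show ?thesis
        using inf(1) unfolding P_def by (intro exI[of _ "{..n}"] exI[of _ a]) auto
    qed
  qed
  then obtain J and a :: "nat \<Rightarrow> complex" where J: "finite J" "\<forall>j\<in>J. norm (a j) < 1"
      "\<forall>z. norm z < 1 \<longrightarrow> norm (moeb b (F z)) \<le> (\<Prod>j\<in>J. norm (moeb (a j) z))"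
      and J_le: "(\<Prod>j\<in>J. norm (moeb (a j) w)) \<le> norm (moeb b (F w)) + e"
    by (elim exE conjE) (rule that)
  obtain S where S: "finite S" "S \<subseteq> fiber F b"
      "(\<Prod>a\<in>S. norm (moeb a w) ^ mult_at F a) \<le> (\<Prod>j\<in>J. norm (moeb (a j) w))"
    using prod_fiber_le[OF F F1 b J(1) J(2)[rule_format] J(3)[rule_format] w] by auto
  show "\<exists>S. finite S \<and> S \<subseteq> fiber F b \<and>
      (\<Prod>a\<in>S. norm (moeb a w) ^ mult_at F a) \<le> norm (moeb b (F w)) + e"
    using S order_trans[OF S(3) J_le] by blast
qed

text \<open>
  Stated without quotients so that it remains valid for \<open>norm (K w) = 1\<close>, where it forces \<open>K\<close> to be
  constant; this case is reached by scaling \<open>K\<close> with \<open>t < 1\<close> and letting \<open>t\<close> tend to 1.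
\<close>

lemma Schwarz_Pick_bound:
  assumes K: "K holomorphic_on ball 0 1" "\<And>z. norm z < 1 \<Longrightarrow> norm (K z) \<le> 1"
    and w: "norm w < 1" and z: "norm z < 1"
  shows "(norm (1 - cnj (K w) * K z))\<^sup>2 * (1 - (norm (moeb w z))\<^sup>2) \<le> 1 - (norm (K w))\<^sup>2"
proof (rule tendsto_le)
  have bound: "(norm (1 - of_real (t\<^sup>2) * (cnj (K w) * K z)))\<^sup>2 * (1 - (norm (moeb w z))\<^sup>2)
      \<le> 1 - t\<^sup>2 * (norm (K w))\<^sup>2" if t: "0 < t" "t < 1" for t :: real
  proof -
    define f where "f = (\<lambda>u. of_real t * K u)"
    have f1: "norm (f u) < 1" if "norm u < 1" for u
    proof -
      have "norm (f u) \<le> t"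
        using t K(2)[OF that] by (simp add: f_def norm_mult mult_left_le)
      then show ?thesis
        using t by simp
    qed
    have "f holomorphic_on ball 0 1"
      unfolding f_def by (intro holomorphic_intros K)
    then have hol: "moeb (f w) \<circ> f holomorphic_on ball 0 1"
      using f1 by (intro holomorphic_on_compose_gen[OF _ Moebius_function_holomorphic[OF f1[OF w]]]) auto
    obtain L where L: "norm (L z) \<le> 1" "(moeb (f w) \<circ> f) z = moeb w z * L z"
    proof (rule Schwarz_quotient[OF hol _ w])
      show "norm ((moeb (f w) \<circ> f) u) \<le> 1" if "norm u < 1" for u
        using norm_moeb_le_1[OF f1[OF w] f1[OF that]] by simp
      show "(moeb (f w) \<circ> f) w = 0"
        by (simp add: Moebius_function_eq_zero)
    qed (use z in blast)
    then have "norm (moeb (f w) (f z)) \<le> norm (moeb w z)"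
      by (simp add: norm_mult mult_left_le)
    then have "1 - (norm (moeb w z))\<^sup>2 \<le> 1 - (norm (moeb (f w) (f z)))\<^sup>2"
      by (simp add: power_mono)
    also have "\<dots> = (1 - (norm (f w))\<^sup>2) * (1 - (norm (f z))\<^sup>2) / (norm (1 - cnj (f w) * f z))\<^sup>2"
      by (rule one_minus_norm_moeb_sq[OF f1[OF w] f1[OF z]])
    finally have "(norm (1 - cnj (f w) * f z))\<^sup>2 * (1 - (norm (moeb w z))\<^sup>2)
        \<le> (1 - (norm (f w))\<^sup>2) * (1 - (norm (f z))\<^sup>2)"
      using moeb_denom_nonzero[OF f1[OF w] f1[OF z]] by (simp add: pos_le_divide_eq mult.commute)
    also have "\<dots> \<le> 1 - (norm (f w))\<^sup>2"
      using f1[OF w] by (intro mult_left_le) (auto simp: power_le_one)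
    also have "1 - (norm (f w))\<^sup>2 = 1 - t\<^sup>2 * (norm (K w))\<^sup>2"
      using t by (simp add: f_def norm_mult power_mult_distrib)
    also have "cnj (f w) * f z = of_real (t\<^sup>2) * (cnj (K w) * K z)"
      by (simp add: f_def power2_eq_square)
    finally show ?thesis .
  qed
  show "\<forall>\<^sub>F t in at_left (1::real). (norm (1 - of_real (t\<^sup>2) * (cnj (K w) * K z)))\<^sup>2 *
      (1 - (norm (moeb w z))\<^sup>2) \<le> 1 - t\<^sup>2 * (norm (K w))\<^sup>2"
    by (rule eventually_mono[OF eventually_at_left_real[of 0 1]]) (simp, rule bound, auto)
  show "((\<lambda>t. 1 - t\<^sup>2 * (norm (K w))\<^sup>2) \<longlongrightarrow> 1 - (norm (K w))\<^sup>2) (at_left 1)"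
    by (auto intro!: tendsto_eq_intros)
  have "((\<lambda>t. (norm (1 - of_real (t\<^sup>2) * (cnj (K w) * K z)))\<^sup>2 * (1 - (norm (moeb w z))\<^sup>2)) \<longlongrightarrow>
      (norm (1 - of_real (1\<^sup>2) * (cnj (K w) * K z)))\<^sup>2 * (1 - (norm (moeb w z))\<^sup>2)) (at_left 1)"
    by (intro tendsto_intros)
  then show "((\<lambda>t. (norm (1 - of_real (t\<^sup>2) * (cnj (K w) * K z)))\<^sup>2 * (1 - (norm (moeb w z))\<^sup>2)) \<longlongrightarrow>
      (norm (1 - cnj (K w) * K z))\<^sup>2 * (1 - (norm (moeb w z))\<^sup>2)) (at_left 1)"
    by simp
qed simp

lemma tendsto_unimodular_const:
  assumes K: "\<And>n::nat. K n holomorphic_on ball 0 1" "\<And>n z. norm z < 1 \<Longrightarrow> norm (K n z) \<le> 1"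
    and w: "norm w < 1" and z: "norm z < 1"
    and lim: "(\<lambda>n. K n w) \<longlonglongrightarrow> \<eta>" and \<eta>: "norm \<eta> = 1"
  shows "(\<lambda>n. K n z) \<longlonglongrightarrow> \<eta>"
proof -
  define \<delta> where "\<delta> = 1 - (norm (moeb w z))\<^sup>2"
  have \<delta>: "\<delta> > 0"
    using Moebius_function_norm_lt_1[OF w z, of 0] by (simp add: \<delta>_def power_less_one_iff)
  have "(\<lambda>n. norm (1 - cnj (K n w) * K n z)) \<longlonglongrightarrow> 0"
  proof (rule tendsto_sandwich[where f = "\<lambda>_. 0"])
    show "\<forall>\<^sub>F n in sequentially. norm (1 - cnj (K n w) * K n z) \<le> sqrt ((1 - (norm (K n w))\<^sup>2) / \<delta>)"
    proof (intro always_eventually allI real_le_rsqrt)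
      show "(norm (1 - cnj (K n w) * K n z))\<^sup>2 \<le> (1 - (norm (K n w))\<^sup>2) / \<delta>" for n
        using Schwarz_Pick_bound[OF K w z] \<delta> by (simp add: pos_le_divide_eq \<delta>_def)
    qed
    have "(\<lambda>n. sqrt ((1 - (norm (K n w))\<^sup>2) / \<delta>)) \<longlonglongrightarrow> sqrt ((1 - (norm \<eta>)\<^sup>2) / \<delta>)"
      using \<delta> by (intro tendsto_intros lim) auto
    then show "(\<lambda>n. sqrt ((1 - (norm (K n w))\<^sup>2) / \<delta>)) \<longlonglongrightarrow> 0"
      by (simp add: \<eta>)
  qed auto
  moreover have "(\<lambda>n. norm (K n w - \<eta>)) \<longlonglongrightarrow> 0"
    using lim by (simp add: LIM_zero tendsto_norm_zero)
  ultimately have "(\<lambda>n. norm (1 - cnj (K n w) * K n z) + norm (K n w - \<eta>)) \<longlonglongrightarrow> 0"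
    using tendsto_add by fastforce
  moreover have "norm (K n z - \<eta>) \<le> norm (1 - cnj (K n w) * K n z) + norm (K n w - \<eta>)" for n
  proof -
    have "\<eta> * cnj \<eta> = 1"
      using \<eta> complex_norm_square[of \<eta>] by simp
    then have "K n z - \<eta> = \<eta> * (cnj \<eta> * K n z - 1)"
      by (simp add: algebra_simps flip: mult.assoc)
    then have "norm (K n z - \<eta>) = norm (cnj \<eta> * K n z - 1)"
      by (simp add: norm_mult \<eta>)
    also have "cnj \<eta> * K n z - 1 = - (1 - cnj (K n w) * K n z) - cnj (K n w - \<eta>) * K n z"
      by (simp add: algebra_simps)
    also have "norm \<dots> \<le> norm (1 - cnj (K n w) * K n z) + norm (cnj (K n w - \<eta>) * K n z)"
      using norm_triangle_ineq4 norm_minus_cancel by metis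
    also have "norm (cnj (K n w - \<eta>) * K n z) \<le> norm (K n w - \<eta>)"
      using K(2)[OF z] unfolding norm_mult complex_mod_cnj by (intro mult_left_le) auto
    finally show ?thesis
      by simp
  qed
  ultimately have "(\<lambda>n. K n z - \<eta>) \<longlonglongrightarrow> 0"
    using Lim_null_comparison by (metis (no_types, lifting) always_eventually)
  then show ?thesis
    by (simp add: LIM_zero_iff)
qed

lemma blaschke_limit:
  assumes F: "F holomorphic_on ball 0 1" "\<not> F constant_on ball 0 1"
    and F1: "\<And>z. norm z < 1 \<Longrightarrow> norm (F z) < 1" and b: "norm b < 1"
    and Q: "\<And>n::nat. finite (Q n)" "\<And>n. Q n \<subseteq> (SIGMA a:fiber F b. {..<mult_at F a})"
    and \<beta>: "\<And>z. norm z < 1 \<Longrightarrow> (\<lambda>n. \<Prod>q\<in>Q n. blaschke_factor (fst q) z) \<longlonglongrightarrow> \<beta> z"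
    and w: "norm w < 1" "F w \<noteq> b" and eq: "norm (\<beta> w) = norm (moeb b (F w))"
  shows "\<exists>\<eta>. norm \<eta> = 1 \<and> (\<forall>z. norm z < 1 \<longrightarrow> moeb b (F z) = \<eta> * \<beta> z)"
proof -
  have "\<forall>n. \<exists>K. K holomorphic_on ball 0 1 \<and> (\<forall>z. norm z < 1 \<longrightarrow> norm (K z) \<le> 1) \<and>
           (\<forall>z. norm z < 1 \<longrightarrow> moeb b (F z) = (\<Prod>q\<in>Q n. moeb (fst q) z) * K z)"
    using Lindelof_quotient[OF F F1 b Q] by blast
  then obtain K where K: "\<And>n. K n holomorphic_on ball 0 1" "\<And>n z. norm z < 1 \<Longrightarrow> norm (K n z) \<le> 1"
      "\<And>n z. norm z < 1 \<Longrightarrow> moeb b (F z) = (\<Prod>q\<in>Q n. moeb (fst q) z) * K n z"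
    by metis
  define U where "U = (\<lambda>n. \<Prod>q\<in>Q n. unit_factor (fst q))"
  have U: "norm (U n) = 1" for n
    by (simp add: U_def norm_unit_factor flip: prod_norm)
  define L where "L = (\<lambda>n z. cnj (U n) * K n z)"
  define P where "P = (\<lambda>n z. \<Prod>q\<in>Q n. blaschke_factor (fst q) z)"
  have L: "L n holomorphic_on ball 0 1" for n
    unfolding L_def by (intro holomorphic_intros K)
  have L1: "norm (L n z) \<le> 1" if "norm z < 1" for n z
    using K(2)[OF that] by (simp add: L_def norm_mult U)
  have PL: "moeb b (F z) = P n z * L n z" if "norm z < 1" for n z
  proof -
    have "P n z * L n z = (U n * cnj (U n)) * ((\<Prod>q\<in>Q n. moeb (fst q) z) * K n z)"
      by (simp add: P_def L_def U_def blaschke_factor_moeb prod.distrib)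
    also have "U n * cnj (U n) = 1"
      using complex_norm_square[of "U n"] by (simp add: U)
    finally show ?thesis
      using K(3)[OF that] by simp
  qed
  define \<eta> where "\<eta> = moeb b (F w) / \<beta> w"
  have nz: "moeb b (F w) \<noteq> 0"
    using w moeb_eq_0_iff[OF b F1[OF w(1)]] by simp
  with eq have "\<beta> w \<noteq> 0"
    by auto
  then have \<eta>: "norm \<eta> = 1"
    using eq nz by (simp add: \<eta>_def norm_divide)
  have "(\<lambda>n. moeb b (F w) / P n w) \<longlonglongrightarrow> \<eta>"
    unfolding \<eta>_def P_def by (intro tendsto_intros \<beta> w \<open>\<beta> w \<noteq> 0\<close>)
  moreover have "moeb b (F w) / P n w = L n w" for n
    using PL[OF w(1), of n] nz by auto
  ultimately have lim: "(\<lambda>n. L n w) \<longlonglongrightarrow> \<eta>"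
    by simp
  have "moeb b (F z) = \<eta> * \<beta> z" if z: "norm z < 1" for z
  proof (rule LIMSEQ_unique)
    show "(\<lambda>n. L n z * P n z) \<longlonglongrightarrow> \<eta> * \<beta> z"
      using tendsto_mult[OF tendsto_unimodular_const[OF L L1 w(1) z lim \<eta>] \<beta>[OF z]] by (simp add: P_def)
    show "(\<lambda>n. L n z * P n z) \<longlonglongrightarrow> moeb b (F z)"
      using PL[OF z] by (simp add: mult.commute)
  qed
  with \<eta> show ?thesis
    by blast
qed

lemma one_minus_norm_le_moeb:
  assumes "norm a < 1" "norm w < 1"
  shows "1 - norm a \<le> 8 / (1 - (norm w)\<^sup>2) * (1 - norm (moeb a w))"
proof -
  define r where "r = norm (moeb a w)"
  have r: "0 \<le> r" "r \<le> 1"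
    using norm_moeb_le_1[OF assms] by (auto simp: r_def)
  have w: "0 < 1 - (norm w)\<^sup>2"
    using assms by (simp add: power_less_one_iff)
  have "(norm a)\<^sup>2 \<le> norm a"
    using assms by (simp add: power2_eq_square mult_left_le)
  have "norm (cnj a * w) \<le> 1"
    using assms by (simp add: norm_mult mult_le_one)
  then have "norm (1 - cnj a * w) \<le> 2"
    using norm_triangle_ineq4[of 1 "cnj a * w"] by simp
  then have "(norm (1 - cnj a * w))\<^sup>2 \<le> 2\<^sup>2"
    by (intro power_mono) auto
  have "(1 - norm a) * (1 - (norm w)\<^sup>2) \<le> (1 - (norm a)\<^sup>2) * (1 - (norm w)\<^sup>2)"
    using \<open>(norm a)\<^sup>2 \<le> norm a\<close> w by (intro mult_right_mono) auto
  also have "\<dots> = (1 - r\<^sup>2) * (norm (1 - cnj a * w))\<^sup>2"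
    using one_minus_norm_moeb_sq[OF assms] moeb_denom_nonzero[OF assms] by (simp add: r_def)
  also have "\<dots> \<le> (1 - r\<^sup>2) * 2\<^sup>2"
    using r \<open>(norm (1 - cnj a * w))\<^sup>2 \<le> 2\<^sup>2\<close> by (intro mult_left_mono) (auto simp: power_le_one)
  also have "1 - r\<^sup>2 = (1 - r) * (1 + r)"
    by (simp add: power2_eq_square algebra_simps)
  also have "\<dots> \<le> (1 - r) * 2"
    using r by (intro mult_left_mono) auto
  finally have "(1 - norm a) * (1 - (norm w)\<^sup>2) \<le> 8 * (1 - r)"
    by simp
  then show ?thesis
    using w by (simp add: r_def pos_le_divide_eq)
qed

lemma fsigma_unit_disc: "fsigma (ball 0 1 :: complex set)"
proof -
  have "ball 0 1 = (\<Union>n. cball (0::complex) (1 - inverse (real (Suc n))))"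
  proof (intro set_eqI iffI)
    fix x :: complex assume "x \<in> ball 0 1"
    then obtain n where "inverse (real (Suc n)) < 1 - norm x"
      using reals_Archimedean[of "1 - norm x"] by auto
    then show "x \<in> (\<Union>n. cball 0 (1 - inverse (real (Suc n))))"
      by (intro UN_I[of n]) auto
  next
    fix x :: complex assume "x \<in> (\<Union>n. cball 0 (1 - inverse (real (Suc n))))"
    then obtain n where "norm x \<le> 1 - inverse (real (Suc n))"
      by auto
    moreover have "0 < inverse (real (Suc n))"
      by simp
    ultimately show "x \<in> ball 0 1"
      unfolding mem_ball_0 by linarith
  qed
  then show ?thesis
    by (metis fsigma.intros closed_cball)
qed

lemma Lindelof_equality_imp_blaschke_product:
  assumes F: "F holomorphic_on ball 0 1" "\<not> F constant_on ball 0 1"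
    and F1: "\<And>z. norm z < 1 \<Longrightarrow> norm (F z) < 1" and b: "norm b < 1"
    and w: "norm w < 1" "F w \<noteq> b" and eq: "Lindelof_equality F b w" and c: "norm c = 1"
  shows "blaschke_product (\<lambda>z. c * moeb b (F z))"
proof -
  define Z where "Z = (SIGMA a:fiber F b. {..<mult_at F a})"
  define N where "N = (\<lambda>Q :: (complex \<times> nat) set. \<Prod>q\<in>Q. norm (moeb (fst q) w))"
  have Z1: "norm (fst q) < 1" if "q \<in> Z" for q
    using that by (auto simp: Z_def fiber_def)
  have G_pos: "0 < norm (moeb b (F w))"
    using w moeb_eq_0_iff[OF b F1[OF w(1)]] by simp
  have N_ge: "norm (moeb b (F w)) \<le> N Q" if Q: "finite Q" "Q \<subseteq> Z" for Q
  proof -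
    obtain K where "norm (K w) \<le> 1" "moeb b (F w) = (\<Prod>q\<in>Q. moeb (fst q) w) * K w"
      using Lindelof_quotient[OF F F1 b, of Q] Q w by (auto simp: Z_def)
    then show ?thesis
      by (simp add: N_def norm_mult prod_norm mult_left_le)
  qed
  have N_approx: "\<exists>Q0. finite Q0 \<and> Q0 \<subseteq> Z \<and> (\<forall>Q. finite Q \<and> Q0 \<subseteq> Q \<and> Q \<subseteq> Z \<longrightarrow> N Q \<le> norm (moeb b (F w)) + e)"
    if "e > 0" for e
  proof -
    obtain S where S: "finite S" "S \<subseteq> fiber F b"
        and le: "(\<Prod>a\<in>S. norm (moeb a w) ^ mult_at F a) \<le> norm (moeb b (F w)) + e"
      using eq \<open>e > 0\<close> unfolding Lindelof_equality_def by blast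
    define Q0 where "Q0 = (SIGMA a:S. {..<mult_at F a})"
    have "N Q0 = (\<Prod>a\<in>S. \<Prod>i<mult_at F a. norm (moeb a w))"
      using S unfolding N_def Q0_def by (subst prod.Sigma) (simp_all add: split_def)
    also have "\<dots> \<le> norm (moeb b (F w)) + e"
      using le by simp
    finally have Q0: "N Q0 \<le> norm (moeb b (F w)) + e" .
    have "N Q \<le> N Q0" if Q: "finite Q" "Q0 \<subseteq> Q" "Q \<subseteq> Z" for Q
    proof -
      have "N Q = N (Q - Q0) * N Q0"
        unfolding N_def by (rule prod.subset_diff[OF Q(2,1)])
      also have "\<dots> \<le> 1 * N Q0"
        unfolding N_def using Q(3) Z1 norm_moeb_le_1[OF _ w(1)]
        by (intro mult_right_mono prod_le_1 prod_nonneg) auto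
      finally show ?thesis
        by simp
    qed
    with Q0 S show ?thesis
      by (intro exI[of _ Q0]) (auto simp: Q0_def Z_def intro: order_trans)
  qed
  show ?thesis
  proof (cases "finite Z")
    case True
    have "N Z \<le> norm (moeb b (F w))"
    proof (rule field_le_epsilon)
      show "N Z \<le> norm (moeb b (F w)) + e" if "e > 0" for e
        using N_approx[OF that] True by blast
    qed
    with N_ge[of Z] True have "N Z = norm (moeb b (F w))"
      by simp
    then obtain \<eta> where \<eta>: "norm \<eta> = 1"
        "\<And>z. norm z < 1 \<Longrightarrow> moeb b (F z) = \<eta> * (\<Prod>q\<in>Z. blaschke_factor (fst q) z)"
      using blaschke_limit[OF F F1 b, of "\<lambda>_. Z" "\<lambda>z. \<Prod>q\<in>Z. blaschke_factor (fst q) z" w] True w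
      by (auto simp: Z_def N_def norm_blaschke_factor simp flip: prod_norm)
    obtain h where h: "bij_betw h {..<card Z} Z"
      using bij_betw_from_nat_into_finite[OF True] by blast
    have "(\<Prod>q\<in>Z. blaschke_factor (fst q) z) = (\<Prod>j<card Z. blaschke_factor (fst (h j)) z)" for z
      by (rule prod.reindex_bij_betw[OF h, symmetric])
    moreover have "norm (fst (h j)) < 1" if "j < card Z" for j
      using h that by (intro Z1) (auto simp: bij_betw_def)
    ultimately show ?thesis
      unfolding blaschke_product_def using \<eta> c
      by (intro exI[of _ "c * \<eta>"] exI[of _ "\<lambda>j. fst (h j)"] conjI disjI1 exI[of _ "card Z"])
        (auto simp: norm_mult)
  next
    case False
    have "countable {z \<in> ball 0 1. F z - b = 0}"
    proof (rule holomorphic_countable_zeros)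
      show "(\<lambda>z. F z - b) holomorphic_on ball 0 1"
        by (intro holomorphic_intros F)
      show "\<not> (\<lambda>z. F z - b) constant_on ball 0 1"
        using F(2) unfolding constant_on_def by (metis diff_add_cancel)
    qed (auto intro: fsigma_unit_disc)
    moreover have "{z \<in> ball 0 1. F z - b = 0} = fiber F b"
      by (auto simp: fiber_def)
    ultimately have "countable Z"
      by (simp add: Z_def)
    then obtain h :: "nat \<Rightarrow> complex \<times> nat" where h: "bij_betw h UNIV Z"
      using bij_betw_from_nat_into[OF _ False] by blast
    then have h_inj: "inj h" and h_range: "range h = Z"
      by (auto simp: bij_betw_def)
    define a where "a = (\<lambda>j. fst (h j))"
    have a1: "norm (a j) < 1" for j
      using h_range unfolding a_def by (intro Z1) auto
    have N_image: "N (h ` J) = (\<Prod>j\<in>J. norm (moeb (a j) w))" for J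
      using h_inj unfolding N_def a_def by (subst prod.reindex) (auto intro: inj_on_subset)
    have fin_image: "finite (h ` J)" "h ` J \<subseteq> Z" if "finite J" for J
      using h_range that by auto
    have a_nz: "moeb (a j) w \<noteq> 0" for j
      using N_ge[OF fin_image, of "{j}"] G_pos N_image[of "{j}"] by auto
    have "summable (\<lambda>j. 1 - norm (a j))"
    proof (rule summableI_nonneg_bounded)
      show "0 \<le> 1 - norm (a j)" for j
        using a1[of j] by simp
      define M where "M = 8 / (1 - (norm w)\<^sup>2)"
      have M: "M \<ge> 0"
        using w by (simp add: M_def power_le_one)
      show "(\<Sum>j<n. 1 - norm (a j)) \<le> M * - ln (norm (moeb b (F w)))" for n
      proof -
        have "1 - norm (a j) \<le> M * - ln (norm (moeb (a j) w))" for j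
        proof -
          have "1 - norm (a j) \<le> M * (1 - norm (moeb (a j) w))"
            unfolding M_def by (rule one_minus_norm_le_moeb[OF a1 w(1)])
          also have "\<dots> \<le> M * - ln (norm (moeb (a j) w))"
            using ln_le_minus_one[of "norm (moeb (a j) w)"] a_nz M by (intro mult_left_mono) auto
          finally show ?thesis .
        qed
        then have "(\<Sum>j<n. 1 - norm (a j)) \<le> (\<Sum>j<n. M * - ln (norm (moeb (a j) w)))"
          by (rule sum_mono)
        also have "\<dots> = M * - ln (N (h ` {..<n}))"
          using a_nz by (simp add: N_image ln_prod sum_distrib_left sum_negf)
        also have "\<dots> \<le> M * - ln (norm (moeb b (F w)))"
          using N_ge[OF fin_image, of "{..<n}"] G_pos M
          by (intro mult_left_mono le_imp_neg_le ln_mono) auto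
        finally show ?thesis .
      qed
    qed
    note lim = blaschke_product_LIMSEQ[of a, OF a1 this]
    define \<beta> where "\<beta> = (\<lambda>z. \<Prod>j. blaschke_factor (a j) z)"
    have "(\<lambda>n. norm (\<Prod>j\<le>n. blaschke_factor (a j) w)) \<longlonglongrightarrow> norm (\<beta> w)"
      unfolding \<beta>_def by (intro tendsto_norm lim w)
    moreover have "norm (\<Prod>j\<le>n. blaschke_factor (a j) w) = N (h ` {..n})" for n
      by (simp only: N_image norm_blaschke_factor flip: prod_norm)
    ultimately have N_lim: "(\<lambda>n. N (h ` {..n})) \<longlonglongrightarrow> norm (\<beta> w)"
      by simp
    have "norm (\<beta> w) \<le> norm (moeb b (F w))"
    proof (rule field_le_epsilon)
      fix e :: real assume "e > 0"
      then obtain Q0 where Q0: "finite Q0" "Q0 \<subseteq> Z"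
          "\<forall>Q. finite Q \<and> Q0 \<subseteq> Q \<and> Q \<subseteq> Z \<longrightarrow> N Q \<le> norm (moeb b (F w)) + e"
        using N_approx by meson
      obtain J where J: "finite J" "Q0 = h ` J"
        using finite_subset_image[OF Q0(1)] Q0(2) h_range by metis
      obtain m where m: "\<forall>j\<in>J. j \<le> m"
        using J(1) finite_nat_set_iff_bounded_le by blast
      have "N (h ` {..n}) \<le> norm (moeb b (F w)) + e" if "n \<ge> m" for n
        using m that by (intro Q0(3)[rule_format] conjI fin_image) (auto simp: J)
      then show "norm (\<beta> w) \<le> norm (moeb b (F w)) + e"
        by (intro LIMSEQ_le_const2[OF N_lim]) blast
    qed
    moreover have "norm (moeb b (F w)) \<le> norm (\<beta> w)"
      using N_ge[OF fin_image] by (intro LIMSEQ_le_const[OF N_lim]) auto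
    ultimately have "norm (\<beta> w) = norm (moeb b (F w))"
      by simp
    moreover have "(\<lambda>n. \<Prod>q\<in>h ` {..n}. blaschke_factor (fst q) z) \<longlonglongrightarrow> \<beta> z" if "norm z < 1" for z
    proof -
      have "(\<Prod>q\<in>h ` {..n}. blaschke_factor (fst q) z) = (\<Prod>j\<le>n. blaschke_factor (a j) z)" for n
        using h_inj unfolding a_def by (subst prod.reindex) (auto intro: inj_on_subset)
      then show ?thesis
        using lim[OF that] by (simp add: \<beta>_def)
    qed
    ultimately obtain \<eta> where \<eta>: "norm \<eta> = 1" "\<And>z. norm z < 1 \<Longrightarrow> moeb b (F z) = \<eta> * \<beta> z"
      using blaschke_limit[OF F F1 b, of "\<lambda>n. h ` {..n}" \<beta> w] w fin_image by (auto simp: Z_def)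
    then show ?thesis
      unfolding blaschke_product_def using c a1 \<open>summable (\<lambda>j. 1 - norm (a j))\<close>
      by (intro exI[of _ "c * \<eta>"] exI[of _ a] conjI disjI2) (auto simp: norm_mult \<beta>_def)
  qed
qed

subsection \<open>Composition\<close>

lemma bounded_by_1_imp_into_disc:
  assumes F: "F holomorphic_on ball 0 1" "\<not> F constant_on ball 0 1"
    and F1: "\<And>z. norm z < 1 \<Longrightarrow> norm (F z) \<le> 1" and z: "norm z < 1"
  shows "norm (F z) < 1"
proof -
  have "open (F ` ball 0 1)"
    by (intro open_mapping_thm[OF F(1) _ _ _ _ F(2)]) auto
  moreover have "F ` ball 0 1 \<subseteq> cball 0 1"
    using F1 by auto
  ultimately have "F ` ball 0 1 \<subseteq> interior (cball 0 1)"
    by (rule interior_maximal[rotated])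
  then show ?thesis
    using z by (auto simp: image_subset_iff)
qed

lemma compose_not_constant_on_disc:
  assumes B: "B holomorphic_on ball 0 1" "\<not> B constant_on ball 0 1"
    and C: "C holomorphic_on ball 0 1" "\<not> C constant_on ball 0 1" "C ` ball 0 1 \<subseteq> ball 0 1"
  shows "\<not> (B \<circ> C) constant_on ball 0 1"
proof
  assume "(B \<circ> C) constant_on ball 0 1"
  then obtain c where c: "\<And>z. z \<in> ball 0 1 \<Longrightarrow> B (C z) = c"
    unfolding constant_on_def by auto
  have "B z = c" if "z \<in> ball 0 1" for z
  proof (rule analytic_continuation_open[of "C ` ball 0 1" "ball 0 1" B "\<lambda>_. c"])
    show "open (C ` ball 0 1)"
      by (intro open_mapping_thm[OF C(1) _ _ _ _ C(2)]) auto
  qed (use B(1) C(3) c that in auto)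
  with B(2) show False
    unfolding constant_on_def by blast
qed

lemma indestructible_blaschke_productI:
  assumes F: "F holomorphic_on ball 0 1" "\<not> F constant_on ball 0 1"
    and F1: "\<And>z. norm z < 1 \<Longrightarrow> norm (F z) < 1"
    and eq: "\<And>b. norm b < 1 \<Longrightarrow> \<exists>w. norm w < 1 \<and> F w \<noteq> b \<and> Lindelof_equality F b w"
  shows "indestructible_blaschke_product F"
proof -
  have bp: "blaschke_product (\<lambda>z. c * moeb b (F z))" if "norm b < 1" "norm c = 1" for b c
    using eq[OF that(1)] Lindelof_equality_imp_blaschke_product[OF F F1 that(1) _ _ _ that(2)] by blast
  have "blaschke_product F"
    using bp[of 0 1] by (simp add: Moebius_function_simple)
  moreover have "blaschke_product (T \<circ> F)" if "T \<in> disc_Aut" for T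
    using that bp by (auto simp: disc_Aut_def o_def Moebius_function_simple)
  ultimately show ?thesis
    unfolding indestructible_blaschke_product_def by blast
qed

lemma prod_fiber_compose:
  assumes B: "B holomorphic_on ball 0 1" "\<not> B constant_on ball 0 1"
    and C: "C holomorphic_on ball 0 1" "\<not> C constant_on ball 0 1"
    and C1: "\<And>z. norm z < 1 \<Longrightarrow> norm (C z) < 1"
    and S: "finite S" "S \<subseteq> fiber (B \<circ> C) b"
  shows "(\<Prod>a\<in>S. norm (moeb a w) ^ mult_at (B \<circ> C) a) =
         (\<Prod>c\<in>C ` S. (\<Prod>a\<in>{a\<in>S. C a = c}. norm (moeb a w) ^ mult_at C a) ^ mult_at B c)"
proof -
  have "(\<Prod>a\<in>S. norm (moeb a w) ^ mult_at (B \<circ> C) a) =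
      (\<Prod>c\<in>C ` S. \<Prod>a\<in>{a\<in>S. C a = c}. norm (moeb a w) ^ mult_at (B \<circ> C) a)"
    by (rule prod.image_gen[OF S(1)])
  also have "\<dots> = (\<Prod>c\<in>C ` S. \<Prod>a\<in>{a\<in>S. C a = c}. (norm (moeb a w) ^ mult_at C a) ^ mult_at B c)"
  proof (intro prod.cong refl)
    fix c a assume "a \<in> {a\<in>S. C a = c}"
    then have "norm a < 1" "C a = c"
      using S by (auto simp: fiber_def)
    then show "norm (moeb a w) ^ mult_at (B \<circ> C) a = (norm (moeb a w) ^ mult_at C a) ^ mult_at B c"
      using mult_at_compose[OF C _ B C1] by (simp add: mult.commute flip: power_mult)
  qed
  finally show ?thesis
    by (simp add: prod_power_distrib)
qed

lemma Lindelof_equality_outer: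
  assumes B: "B holomorphic_on ball 0 1" "\<not> B constant_on ball 0 1"
    and C: "C holomorphic_on ball 0 1" "\<not> C constant_on ball 0 1"
    and C1: "\<And>z. norm z < 1 \<Longrightarrow> norm (C z) < 1"
    and w: "norm w < 1" and eq: "Lindelof_equality (B \<circ> C) b w"
  shows "Lindelof_equality B b (C w)"
  unfolding Lindelof_equality_def
proof (intro allI impI)
  fix e :: real assume "e > 0"
  then obtain S where S: "finite S" "S \<subseteq> fiber (B \<circ> C) b"
      and le: "(\<Prod>a\<in>S. norm (moeb a w) ^ mult_at (B \<circ> C) a) \<le> norm (moeb b (B (C w))) + e"
    using eq unfolding Lindelof_equality_def by auto
  have S_fiber: "{a\<in>S. C a = c} \<subseteq> fiber C c" "finite {a\<in>S. C a = c}" for c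
    using S by (auto simp: fiber_def)
  have c1: "norm c < 1" if "c \<in> C ` S" for c
    using that S C1 by (auto simp: fiber_def)
  have "(\<Prod>c\<in>C ` S. norm (moeb c (C w)) ^ mult_at B c) \<le>
      (\<Prod>c\<in>C ` S. (\<Prod>a\<in>{a\<in>S. C a = c}. norm (moeb a w) ^ mult_at C a) ^ mult_at B c)"
    using Lindelof_inequality[OF C C1 c1 S_fiber(2,1) w] by (intro prod_mono conjI power_mono) auto
  also have "\<dots> \<le> norm (moeb b (B (C w))) + e"
    using le prod_fiber_compose[OF B C C1 S] by simp
  finally show "\<exists>S. finite S \<and> S \<subseteq> fiber B b \<and>
      (\<Prod>c\<in>S. norm (moeb c (C w)) ^ mult_at B c) \<le> norm (moeb b (B (C w))) + e"
    using S c1 by (intro exI[of _ "C ` S"]) (auto simp: fiber_def)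
qed

lemma add_powers_le_power_add:
  fixes x y :: real
  assumes "0 \<le> x" "0 \<le> y" "0 < m"
  shows "x ^ m + y ^ m \<le> (x + y) ^ m"
proof -
  obtain k where k: "m = Suc k"
    using assms by (cases m) auto
  have "x * x ^ k + y * y ^ k \<le> x * (x + y) ^ k + y * (x + y) ^ k"
    using assms by (intro add_mono mult_left_mono power_mono) auto
  then show ?thesis
    by (simp add: k algebra_simps)
qed

lemma Lindelof_equality_inner:
  assumes B: "B holomorphic_on ball 0 1" "\<not> B constant_on ball 0 1"
    and B1: "\<And>z. norm z < 1 \<Longrightarrow> norm (B z) < 1"
    and C: "C holomorphic_on ball 0 1" "\<not> C constant_on ball 0 1"
    and C1: "\<And>z. norm z < 1 \<Longrightarrow> norm (C z) < 1"
    and c: "norm c < 1" and w: "norm w < 1" "B (C w) \<noteq> B c"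
    and eq: "Lindelof_equality (B \<circ> C) (B c) w"
  shows "Lindelof_equality C c w"
  unfolding Lindelof_equality_def
proof (intro allI impI)
  fix e :: real assume e: "e > 0"
  define m where "m = mult_at B c"
  define R where "R = norm (moeb (B c) (B (C w)))"
  define r where "r = norm (moeb c (C w))"
  have m: "m > 0"
    using mult_at_pos[OF B c] by (simp add: m_def)
  have R: "R > 0"
    using moeb_eq_0_iff[OF B1[OF c] B1[OF C1[OF w(1)]]] w by (simp add: R_def)
  \<comment> \<open>The slack \<open>R * e ^ m\<close> turns into an error \<open>e\<close> after dividing by \<open>Y \<ge> R\<close> and taking \<open>m\<close>-th roots.\<close>
  then have "R * e ^ m > 0"
    using e by simp
  then obtain S where S: "finite S" "S \<subseteq> fiber (B \<circ> C) (B c)"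
      and le: "(\<Prod>a\<in>S. norm (moeb a w) ^ mult_at (B \<circ> C) a) \<le> R + R * e ^ m"
    using eq unfolding Lindelof_equality_def R_def by auto
  define X where "X = (\<lambda>d. \<Prod>a\<in>{a\<in>S. C a = d}. norm (moeb a w) ^ mult_at C a)"
  have S_fiber: "{a\<in>S. C a = d} \<subseteq> fiber C d" "finite {a\<in>S. C a = d}" for d
    using S by (auto simp: fiber_def)
  define D where "D = C ` S - {c}"
  have D: "finite D" "norm d < 1" "B d = B c" if "d \<in> D" for d
    using that S C1 by (auto simp: D_def fiber_def)
  have "finite D"
    using S by (simp add: D_def)
  define Y where "Y = (\<Prod>d\<in>D. norm (moeb d (C w)) ^ mult_at B d)"
  have "(\<Prod>a\<in>S. norm (moeb a w) ^ mult_at (B \<circ> C) a) = (\<Prod>d\<in>insert c (C ` S). X d ^ mult_at B d)"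
  proof -
    have "(\<Prod>a\<in>S. norm (moeb a w) ^ mult_at (B \<circ> C) a) = (\<Prod>d\<in>C ` S. X d ^ mult_at B d)"
      unfolding X_def by (rule prod_fiber_compose[OF B C C1 S])
    also have "\<dots> = (\<Prod>d\<in>insert c (C ` S). X d ^ mult_at B d)"
    proof (rule prod.mono_neutral_left)
      show "\<forall>d\<in>insert c (C ` S) - C ` S. X d ^ mult_at B d = 1"
      proof
        fix d assume "d \<in> insert c (C ` S) - C ` S"
        then have "{a\<in>S. C a = d} = {}"
          by auto
        then show "X d ^ mult_at B d = 1"
          unfolding X_def by (simp only: prod.empty power_one)
      qed
    qed (use S in auto)
    finally show ?thesis .
  qed
  also have "\<dots> = X c ^ m * (\<Prod>d\<in>D. X d ^ mult_at B d)"
    unfolding D_def m_def by (rule prod.insert_remove) (use S in simp)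
  finally have "X c ^ m * (\<Prod>d\<in>D. X d ^ mult_at B d) \<le> R + R * e ^ m"
    using le by simp
  moreover have "Y \<le> (\<Prod>d\<in>D. X d ^ mult_at B d)"
    unfolding Y_def X_def using Lindelof_inequality[OF C C1 D(2) S_fiber(2,1) w(1)]
    by (intro prod_mono conjI power_mono) auto
  moreover have "X c \<ge> 0"
    by (simp add: X_def prod_nonneg)
  ultimately have XY: "X c ^ m * Y \<le> R + R * e ^ m"
    by (meson mult_left_mono order_trans zero_le_power)
  have "R \<le> (\<Prod>d\<in>insert c D. norm (moeb d (C w)) ^ mult_at B d)"
    unfolding R_def using \<open>finite D\<close> D c
    by (intro Lindelof_inequality[OF B B1 B1[OF c] _ _ C1[OF w(1)]]) (auto simp: fiber_def)
  also have "\<dots> = r ^ m * Y"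
    unfolding r_def m_def Y_def by (rule prod.insert) (use \<open>finite D\<close> in \<open>auto simp: D_def\<close>)
  finally have R_le: "R \<le> r ^ m * Y" .
  have r: "0 \<le> r" "r \<le> 1"
    using norm_moeb_le_1[OF c C1[OF w(1)]] by (auto simp: r_def)
  have "0 \<le> Y"
    by (simp add: Y_def prod_nonneg)
  then have "R \<le> Y"
    using R_le mult_right_mono[OF power_le_one[OF r, of m], of Y] by linarith
  have "R * e ^ m \<le> Y * e ^ m"
    using \<open>R \<le> Y\<close> e by (intro mult_right_mono) auto
  with XY R_le have "X c ^ m * Y \<le> r ^ m * Y + Y * e ^ m"
    by linarith
  then have "X c ^ m * Y \<le> (r ^ m + e ^ m) * Y"
    by (simp add: algebra_simps)
  then have "X c ^ m \<le> r ^ m + e ^ m"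
    using \<open>R \<le> Y\<close> R by simp
  also have "\<dots> \<le> (r + e) ^ m"
    using r e m by (intro add_powers_le_power_add) auto
  finally have "X c \<le> r + e"
    using r e m by (simp add: power_mono_iff \<open>X c \<ge> 0\<close>)
  then show "\<exists>S. finite S \<and> S \<subseteq> fiber C c \<and>
      (\<Prod>a\<in>S. norm (moeb a w) ^ mult_at C a) \<le> norm (moeb c (C w)) + e"
    using S_fiber unfolding X_def r_def by blast
qed

theorem theorem1p2:
  fixes B C :: "complex \<Rightarrow> complex"
  assumes "B \<in> H_infty" and "C \<in> H_infty"
    and "\<not> B constant_on ball 0 1" and "\<not> C constant_on ball 0 1"
    and "C ` ball 0 1 \<subseteq> ball 0 1"
    and "\<forall>z\<in>ball 0 1. norm (B z) \<le> 1"
    and "indestructible_blaschke_product (B \<circ> C)"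
  shows "indestructible_blaschke_product B \<and> indestructible_blaschke_product C"
proof -
  have B: "B holomorphic_on ball 0 1" "\<not> B constant_on ball 0 1"
    and C: "C holomorphic_on ball 0 1" "\<not> C constant_on ball 0 1"
    using assms by (auto simp: H_infty_def)
  have C1: "norm (C z) < 1" if "norm z < 1" for z
    using assms(5) that by (auto simp: image_subset_iff)
  have B1: "norm (B z) < 1" if "norm z < 1" for z
    using bounded_by_1_imp_into_disc[OF B] assms(6) that by auto
  have BC: "(B \<circ> C) holomorphic_on ball 0 1" "\<not> (B \<circ> C) constant_on ball 0 1"
    by (rule holomorphic_on_compose_gen[OF C(1) B(1) assms(5)])
      (rule compose_not_constant_on_disc[OF B C assms(5)])
  have BC1: "norm ((B \<circ> C) z) < 1" if "norm z < 1" for z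
    using B1 C1 that by simp
  have eqBC: "Lindelof_equality (B \<circ> C) b w" if "norm b < 1" "norm w < 1" for b w
  proof (rule blaschke_product_imp_Lindelof_equality[OF BC BC1 that])
    have "moeb b \<in> disc_Aut"
      unfolding disc_Aut_def using that(1)
      by (intro CollectI exI[of _ 1] exI[of _ b]) (auto simp: Moebius_function_simple)
    then have "blaschke_product (moeb b \<circ> (B \<circ> C))"
      using assms(7) unfolding indestructible_blaschke_product_def by blast
    then show "blaschke_product (\<lambda>z. moeb b ((B \<circ> C) z))"
      by (simp add: o_def)
  qed
  have ex_w: "\<exists>w. norm w < 1 \<and> B (C w) \<noteq> b" for b
    using BC(2) unfolding constant_on_def Bex_def Ball_def o_apply mem_ball_0 by blast
  have "indestructible_blaschke_product B"
  proof (rule indestructible_blaschke_productI[OF B B1])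
    fix b :: complex assume b: "norm b < 1"
    obtain w where w: "norm w < 1" "B (C w) \<noteq> b"
      using ex_w by blast
    then show "\<exists>w. norm w < 1 \<and> B w \<noteq> b \<and> Lindelof_equality B b w"
      using Lindelof_equality_outer[OF B C C1 w(1) eqBC[OF b w(1)]] C1 by blast
  qed
  moreover have "indestructible_blaschke_product C"
  proof (rule indestructible_blaschke_productI[OF C C1])
    fix c :: complex assume c: "norm c < 1"
    obtain w where w: "norm w < 1" "B (C w) \<noteq> B c"
      using ex_w by blast
    then have "Lindelof_equality C c w"
      using Lindelof_equality_inner[OF B B1 C C1 c w eqBC[OF B1[OF c] w(1)]] by blast
    with w show "\<exists>w. norm w < 1 \<and> C w \<noteq> c \<and> Lindelof_equality C c w"
      by blast
  qed
  ultimately show ?thesis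
    by blast
qed

end
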